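(* For every finite set $X$, the linear map $\Gamma:\mathbb T_X\to\mathbb T_X\otimes\mathbb T_X$ defined on topologies $\mathcal T$ on $X$ by $$\Gamma(\mathcal T)=\sum_{\mathcal T'\ \mathcal T\text{-admissible}}\mathcal T'\otimes\mathcal T/\mathcal T'$$ is coassociative: $(\Gamma\otimes\mathrm{Id})\Gamma=(\mathrm{Id}\otimes\Gamma)\Gamma$.
   Context: For a finite set $X$, $\mathbb T_X$ denotes the vector space (over a field $K$) freely generated by the topologies on $X$. For a topology $\mathcal T$ on $X$, $x\le_{\mathcal T}y$ iff every open set containing $x$ contains $y$ (topologies correspond bijectively to quasi-orders, open sets being final segments); $x\sim_{\mathcal T}y$ iff $x\le_{\mathcal T}y$ and $y\le_{\mathcal T}x$. Write $\mathcal T'\prec\mathcal T$ when every $\mathcal T$-open set is $\mathcal T'$-open. For $\mathcal T'\prec\mathcal T$, $\mathcal T/\mathcal T'$ is the topology on $X$ whose quasi-order is the transitive closure of $x\,\mathcal R\,y\iff(x\le_{\mathcal T}y\text{ or }y\le_{\mathcal T'}x)$. For $Y\subset X$, $\mathcal T|_Y=\{Z\cap Y:Z\in\mathcal T\}$; $Y$ is $\mathcal T$-connected if $(Y,\mathcal T|_Y)$ is connected. $\mathcal T'$ is $\mathcal T$-admissible if $\mathcal T'\prec\mathcal T$, $\mathcal T'|_Y=\mathcal T|_Y$ for every $\mathcal T'$-connected $Y\subset X$, and $x\sim_{\mathcal T/\mathcal T'}y\iff x\sim_{\mathcal T'/\mathcal T'}y$ for all $x,y$. *)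

theory Defs
  imports "HOL-Analysis.Analysis" "HOL-Library.Poly_Mapping"
begin

section \<open>Free vector spaces and their tensor products\<close>

text \<open>
  The free \<open>'k\<close>-vector space on a set \<open>S\<close> consists of the finitely supported functions
  with support in \<open>S\<close>; a basis element \<open>s\<close> is \<open>Poly_Mapping.single s 1\<close>.
\<close>

definition free_vs :: "'b set \<Rightarrow> ('b \<Rightarrow>\<^sub>0 'k::field) set" where
  "free_vs S = {v. Poly_Mapping.keys v \<subseteq> S}"

abbreviation basis_elt :: "'b \<Rightarrow> ('b \<Rightarrow>\<^sub>0 'k::field)" where
  "basis_elt b \<equiv> Poly_Mapping.single b 1"

definition fscale :: "'k::field \<Rightarrow> ('b \<Rightarrow>\<^sub>0 'k) \<Rightarrow> ('b \<Rightarrow>\<^sub>0 'k)" where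
  "fscale c v = Poly_Mapping.map ((*) c) v"

definition lin_ext :: "('b \<Rightarrow> ('c \<Rightarrow>\<^sub>0 'k::field)) \<Rightarrow> ('b \<Rightarrow>\<^sub>0 'k) \<Rightarrow> ('c \<Rightarrow>\<^sub>0 'k)" where
  "lin_ext f v = (\<Sum>b\<in>Poly_Mapping.keys v. fscale (Poly_Mapping.lookup v b) (f b))"

text \<open>
  The tensor product of the free vector spaces on \<open>S\<close> and \<open>S'\<close> is the free vector space on
  \<open>S \<times> S'\<close>, with the pure tensors below (lemma \<open>tensor_universal\<close> is the universal property).
  The map \<open>f \<otimes> g\<close> is determined by its values on the basis
  (lemma \<open>tensor_map_tensor\<close>: it sends \<open>u \<otimes> v\<close> to \<open>f u \<otimes> g v\<close> for linear \<open>f\<close>, \<open>g\<close>).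
\<close>

definition tensor :: "('b \<Rightarrow>\<^sub>0 'k::field) \<Rightarrow> ('c \<Rightarrow>\<^sub>0 'k) \<Rightarrow> ('b \<times> 'c \<Rightarrow>\<^sub>0 'k)"
    (infixr \<open>\<otimes>\<^sub>v\<close> 70) where
  "u \<otimes>\<^sub>v v = (\<Sum>b\<in>Poly_Mapping.keys u. \<Sum>c\<in>Poly_Mapping.keys v.
       Poly_Mapping.single (b, c) (Poly_Mapping.lookup u b * Poly_Mapping.lookup v c))"

definition tensor_map ::
    "(('b \<Rightarrow>\<^sub>0 'k::field) \<Rightarrow> ('d \<Rightarrow>\<^sub>0 'k)) \<Rightarrow> (('c \<Rightarrow>\<^sub>0 'k) \<Rightarrow> ('e \<Rightarrow>\<^sub>0 'k)) \<Rightarrow>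
     ('b \<times> 'c \<Rightarrow>\<^sub>0 'k) \<Rightarrow> ('d \<times> 'e \<Rightarrow>\<^sub>0 'k)" where
  "tensor_map f g = lin_ext (\<lambda>(b, c). f (basis_elt b) \<otimes>\<^sub>v g (basis_elt c))"

text \<open>The canonical isomorphism \<open>(U \<otimes> V) \<otimes> W \<cong> U \<otimes> (V \<otimes> W)\<close>.\<close>

definition tensor_assoc :: "(('b \<times> 'c) \<times> 'd \<Rightarrow>\<^sub>0 'k::field) \<Rightarrow> ('b \<times> 'c \<times> 'd \<Rightarrow>\<^sub>0 'k)" where
  "tensor_assoc = lin_ext (\<lambda>((b, c), d). basis_elt (b, c, d))"

lemma lookup_fscale [simp]: "Poly_Mapping.lookup (fscale c v) b = c * Poly_Mapping.lookup v b"
  by (simp add: fscale_def map.rep_eq when_def)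

lemma vector_space_fscale: "vector_space (fscale :: 'k::field \<Rightarrow> ('b \<Rightarrow>\<^sub>0 'k) \<Rightarrow> _)"
  by unfold_locales (auto intro!: poly_mapping_eqI simp: lookup_add algebra_simps)

lemma linear_sum_keys:
  fixes s :: "'k::field \<Rightarrow> 'w::ab_group_add \<Rightarrow> 'w" and f :: "'b \<Rightarrow> 'w"
  assumes "vector_space s"
  shows "Vector_Spaces.linear fscale s
           (\<lambda>v. \<Sum>b\<in>Poly_Mapping.keys v. s (Poly_Mapping.lookup v b) (f b))"
proof -
  interpret V: vector_space s by fact
  have *: "(\<Sum>b\<in>Poly_Mapping.keys v. s (Poly_Mapping.lookup v b) (f b))
      = (\<Sum>b\<in>A. s (Poly_Mapping.lookup v b) (f b))"
    if "finite A" "Poly_Mapping.keys v \<subseteq> A" for v :: "'b \<Rightarrow>\<^sub>0 'k" and A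
    by (rule sum.mono_neutral_left) (use that in \<open>auto simp: in_keys_iff\<close>)
  show ?thesis
  proof (intro Vector_Spaces.linear_iff[THEN iffD2] conjI allI vector_space_fscale assms)
    fix u v :: "'b \<Rightarrow>\<^sub>0 'k"
    let ?A = "Poly_Mapping.keys u \<union> Poly_Mapping.keys v"
    let ?S = "\<lambda>w. \<Sum>b\<in>Poly_Mapping.keys w. s (Poly_Mapping.lookup w b) (f b)"
    have "?S (u + v) = (\<Sum>b\<in>?A. s (Poly_Mapping.lookup (u + v) b) (f b))"
      by (rule *[OF _ Poly_Mapping.keys_add]) simp
    also have "\<dots> = (\<Sum>b\<in>?A. s (Poly_Mapping.lookup u b) (f b)) +
        (\<Sum>b\<in>?A. s (Poly_Mapping.lookup v b) (f b))"
      by (simp add: lookup_add V.scale_left_distrib sum.distrib)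
    also have "(\<Sum>b\<in>?A. s (Poly_Mapping.lookup u b) (f b)) = ?S u"
      by (rule *[symmetric]) auto
    also have "(\<Sum>b\<in>?A. s (Poly_Mapping.lookup v b) (f b)) = ?S v"
      by (rule *[symmetric]) auto
    finally show "?S (u + v) = ?S u + ?S v" .
  next
    fix c :: 'k and v :: "'b \<Rightarrow>\<^sub>0 'k"
    have "Poly_Mapping.keys (fscale c v) \<subseteq> Poly_Mapping.keys v"
      by (auto simp: in_keys_iff)
    then show "(\<Sum>b\<in>Poly_Mapping.keys (fscale c v). s (Poly_Mapping.lookup (fscale c v) b) (f b)) =
        s c (\<Sum>b\<in>Poly_Mapping.keys v. s (Poly_Mapping.lookup v b) (f b))"
      by (subst *[of "Poly_Mapping.keys v" "fscale c v"]) (simp_all add: V.scale_sum_right)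
  qed
qed

lemma linear_lin_ext: "Vector_Spaces.linear fscale fscale (lin_ext f)"
  unfolding lin_ext_def by (rule linear_sum_keys[OF vector_space_fscale])

lemma fscale_basis: "fscale c (Poly_Mapping.single b d) = Poly_Mapping.single b (c * d)"
  by (rule poly_mapping_eqI) (simp add: lookup_single when_def)

lemma lin_ext_basis [simp]: "lin_ext f (basis_elt b) = f b"
  by (rule poly_mapping_eqI) (simp add: lin_ext_def)

lemma linear_eqI:
  fixes s :: "'k::field \<Rightarrow> 'w::ab_group_add \<Rightarrow> 'w"
  assumes f: "Vector_Spaces.linear fscale s f" and g: "Vector_Spaces.linear fscale s g"
    and eq: "\<And>b. f (basis_elt b) = g (basis_elt b)"
  shows "f v = g v"
proof -
  interpret F: Vector_Spaces.linear fscale s f by fact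
  interpret G: Vector_Spaces.linear fscale s g by fact
  have v: "v = (\<Sum>b\<in>Poly_Mapping.keys v. fscale (Poly_Mapping.lookup v b) (basis_elt b))"
    by (rule poly_mapping_eqI)
       (simp add: lookup_sum lookup_single when_def in_keys_iff if_distrib cong: if_cong)
  show ?thesis
    by (subst (1 2) v) (simp add: F.sum F.scale G.sum G.scale eq)
qed

lemma lookup_tensor [simp]:
  "Poly_Mapping.lookup (u \<otimes>\<^sub>v v) (b, c) = Poly_Mapping.lookup u b * Poly_Mapping.lookup v c"
proof -
  have "Poly_Mapping.lookup (u \<otimes>\<^sub>v v) (b, c) =
     (\<Sum>b'\<in>Poly_Mapping.keys u. \<Sum>c'\<in>Poly_Mapping.keys v. if b' = b then (if c' = c then
        Poly_Mapping.lookup u b' * Poly_Mapping.lookup v c' else 0) else 0)"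
    unfolding tensor_def lookup_sum
    by (intro sum.cong refl) (auto simp: lookup_single when_def)
  also have "\<dots> = (\<Sum>b'\<in>Poly_Mapping.keys u. if b' = b then 
        Poly_Mapping.lookup u b' * Poly_Mapping.lookup v c else 0)"
    by (intro sum.cong refl) (auto simp: in_keys_iff)
  also have "\<dots> = Poly_Mapping.lookup u b * Poly_Mapping.lookup v c"
    by (auto simp: in_keys_iff)
  finally show ?thesis .
qed

lemma tensor_basis [simp]: "basis_elt b \<otimes>\<^sub>v basis_elt c = basis_elt (b, c)"
  by (simp add: tensor_def)

lemma tensor_linear_left: "Vector_Spaces.linear fscale fscale (\<lambda>u. u \<otimes>\<^sub>v v)"
  and tensor_linear_right: "Vector_Spaces.linear fscale fscale (\<lambda>v. u \<otimes>\<^sub>v v)"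
  by (auto intro!: Vector_Spaces.linear_iff[THEN iffD2] vector_space_fscale poly_mapping_eqI
      simp: lookup_add algebra_simps)

lemma bilinear_eqI:
  fixes s :: "'k::field \<Rightarrow> 'w::ab_group_add \<Rightarrow> 'w"
  assumes "\<And>v. Vector_Spaces.linear fscale s (\<lambda>u. f u v)" "\<And>u. Vector_Spaces.linear fscale s (f u)"
    and "\<And>v. Vector_Spaces.linear fscale s (\<lambda>u. g u v)" "\<And>u. Vector_Spaces.linear fscale s (g u)"
    and eq: "\<And>b c. f (basis_elt b) (basis_elt c) = g (basis_elt b) (basis_elt c)"
  shows "f u v = g u v"
proof -
  have "f (basis_elt b) v = g (basis_elt b) v" for b
    by (rule linear_eqI[OF assms(2,4)]) (rule eq)
  then show ?thesis by (rule linear_eqI[OF assms(1,3)])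
qed

lemma linear_compose':
  assumes "Vector_Spaces.linear r s f" "Vector_Spaces.linear s t g"
  shows "Vector_Spaces.linear r t (\<lambda>x. g (f x))"
  using Vector_Spaces.linear_compose[OF assms] by (simp add: o_def)

theorem tensor_universal:
  fixes s :: "'k::field \<Rightarrow> 'w::ab_group_add \<Rightarrow> 'w"
    and \<beta> :: "('b \<Rightarrow>\<^sub>0 'k) \<Rightarrow> ('c \<Rightarrow>\<^sub>0 'k) \<Rightarrow> 'w"
  assumes s: "vector_space s"
    and l: "\<And>v. Vector_Spaces.linear fscale s (\<lambda>u. \<beta> u v)"
    and r: "\<And>u. Vector_Spaces.linear fscale s (\<beta> u)"
  shows "\<exists>!\<phi>. Vector_Spaces.linear fscale s \<phi> \<and> (\<forall>u v. \<phi> (u \<otimes>\<^sub>v v) = \<beta> u v)"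
proof (rule ex_ex1I)
  interpret V: vector_space s by fact
  define \<phi> where "\<phi> = (\<lambda>z. \<Sum>p\<in>Poly_Mapping.keys z. s (Poly_Mapping.lookup z p)
      (case p of (b, c) \<Rightarrow> \<beta> (basis_elt b) (basis_elt c)))"
  have lin: "Vector_Spaces.linear fscale s \<phi>"
    unfolding \<phi>_def by (rule linear_sum_keys[OF s])
  have "\<phi> (u \<otimes>\<^sub>v v) = \<beta> u v" for u v
    by (rule bilinear_eqI[where f = "\<lambda>u v. \<phi> (u \<otimes>\<^sub>v v)" and g = \<beta>,
          OF linear_compose'[OF tensor_linear_left lin] linear_compose'[OF tensor_linear_right lin] l r])
       (simp add: \<phi>_def)
  with lin show "\<exists>\<phi>. Vector_Spaces.linear fscale s \<phi> \<and> (\<forall>u v. \<phi> (u \<otimes>\<^sub>v v) = \<beta> u v)"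
    by blast
next
  fix \<phi> \<psi>
  assume a: "Vector_Spaces.linear fscale s \<phi> \<and> (\<forall>u v. \<phi> (u \<otimes>\<^sub>v v) = \<beta> u v)"
    "Vector_Spaces.linear fscale s \<psi> \<and> (\<forall>u v. \<psi> (u \<otimes>\<^sub>v v) = \<beta> u v)"
  show "\<phi> = \<psi>"
  proof
    fix z :: "('b \<times> 'c) \<Rightarrow>\<^sub>0 'k"
    show "\<phi> z = \<psi> z"
    proof (rule linear_eqI[OF a(1)[THEN conjunct1] a(2)[THEN conjunct1]])
      fix p :: "'b \<times> 'c"
      show "\<phi> (basis_elt p) = \<psi> (basis_elt p)"
        using a by (cases p) (metis tensor_basis)
    qed
  qed
qed

lemma tensor_map_tensor:
  assumes f: "Vector_Spaces.linear fscale fscale f" and g: "Vector_Spaces.linear fscale fscale g"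
  shows "tensor_map f g (u \<otimes>\<^sub>v v) = f u \<otimes>\<^sub>v g v"
  by (rule bilinear_eqI[where f = "\<lambda>u v. tensor_map f g (u \<otimes>\<^sub>v v)" and g = "\<lambda>u v. f u \<otimes>\<^sub>v g v"])
     (auto simp: tensor_map_def intro: linear_compose'[OF tensor_linear_left linear_lin_ext]
        linear_compose'[OF tensor_linear_right linear_lin_ext]
        linear_compose'[OF f tensor_linear_left] linear_compose'[OF g tensor_linear_right])

lemma linear_tensor_assoc: "Vector_Spaces.linear fscale fscale tensor_assoc"
  unfolding tensor_assoc_def by (rule linear_lin_ext)

lemma tensor_assoc_tensor: "tensor_assoc ((u \<otimes>\<^sub>v v) \<otimes>\<^sub>v w) = u \<otimes>\<^sub>v (v \<otimes>\<^sub>v w)"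
proof -
  have 1: "tensor_assoc ((u \<otimes>\<^sub>v v) \<otimes>\<^sub>v basis_elt d) = u \<otimes>\<^sub>v (v \<otimes>\<^sub>v basis_elt d)" for d
    unfolding tensor_assoc_def
    by (rule bilinear_eqI[where f = "\<lambda>u v. lin_ext _ ((u \<otimes>\<^sub>v v) \<otimes>\<^sub>v basis_elt d)"
          and g = "\<lambda>u v. u \<otimes>\<^sub>v (v \<otimes>\<^sub>v basis_elt d)",
          OF linear_compose'[OF linear_compose'[OF tensor_linear_left tensor_linear_left] linear_lin_ext]
             linear_compose'[OF linear_compose'[OF tensor_linear_right tensor_linear_left] linear_lin_ext]
             tensor_linear_left linear_compose'[OF tensor_linear_left tensor_linear_right]])
       simp
  show ?thesis
    by (rule linear_eqI[where f = "\<lambda>w. tensor_assoc ((u \<otimes>\<^sub>v v) \<otimes>\<^sub>v w)"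
          and g = "\<lambda>w. u \<otimes>\<^sub>v (v \<otimes>\<^sub>v w)",
          OF linear_compose'[OF tensor_linear_right linear_tensor_assoc]
             linear_compose'[OF tensor_linear_right tensor_linear_right]])
       (rule 1)
qed


section \<open>Finite topologies and their quasi-orders\<close>

definition topologies_on :: "'a set \<Rightarrow> 'a topology set" where
  "topologies_on X = {T. topspace T = X}"

definition le_top :: "'a topology \<Rightarrow> 'a \<Rightarrow> 'a \<Rightarrow> bool" where
  "le_top T x y \<longleftrightarrow> x \<in> topspace T \<and> y \<in> topspace T \<and> (\<forall>U. openin T U \<longrightarrow> x \<in> U \<longrightarrow> y \<in> U)"

definition sim_top :: "'a topology \<Rightarrow> 'a \<Rightarrow> 'a \<Rightarrow> bool" where
  "sim_top T x y \<longleftrightarrow> le_top T x y \<and> le_top T y x"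

definition finer_top :: "'a topology \<Rightarrow> 'a topology \<Rightarrow> bool" (infix \<open>\<prec>\<^sub>t\<close> 50) where
  "T' \<prec>\<^sub>t T \<longleftrightarrow> topspace T' = topspace T \<and> (\<forall>U. openin T U \<longrightarrow> openin T' U)"

definition final_segment_topology :: "'a set \<Rightarrow> ('a \<Rightarrow> 'a \<Rightarrow> bool) \<Rightarrow> 'a topology" where
  "final_segment_topology X Q = topology (\<lambda>U. U \<subseteq> X \<and> (\<forall>x\<in>U. \<forall>y\<in>X. Q x y \<longrightarrow> y \<in> U))"

definition quot_rel :: "'a topology \<Rightarrow> 'a topology \<Rightarrow> 'a \<Rightarrow> 'a \<Rightarrow> bool" where
  "quot_rel T T' x y \<longleftrightarrow> le_top T x y \<or> le_top T' y x"

definition quot_top :: "'a topology \<Rightarrow> 'a topology \<Rightarrow> 'a topology" (infixl \<open>'/\<^sub>t\<close> 70) where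
  "T /\<^sub>t T' = final_segment_topology (topspace T) (quot_rel T T')\<^sup>+\<^sup>+"

definition admissible :: "'a topology \<Rightarrow> 'a topology \<Rightarrow> bool" where
  "admissible T T' \<longleftrightarrow>
     T' \<prec>\<^sub>t T \<and>
     (\<forall>Y. connectedin T' Y \<longrightarrow> subtopology T' Y = subtopology T Y) \<and>
     (\<forall>x\<in>topspace T. \<forall>y\<in>topspace T. sim_top (T /\<^sub>t T') x y \<longleftrightarrow> sim_top (T' /\<^sub>t T') x y)"

lemma openin_final_segment_topology:
  "openin (final_segment_topology X Q) U \<longleftrightarrow> U \<subseteq> X \<and> (\<forall>x\<in>U. \<forall>y\<in>X. Q x y \<longrightarrow> y \<in> U)"
proof -
  have "istopology (\<lambda>U. U \<subseteq> X \<and> (\<forall>x\<in>U. \<forall>y\<in>X. Q x y \<longrightarrow> y \<in> U))"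
    unfolding istopology_def by blast
  then show ?thesis
    by (simp add: final_segment_topology_def topology_inverse')
qed

lemma topspace_final_segment_topology [simp]: "topspace (final_segment_topology X Q) = X"
  unfolding topspace_def openin_final_segment_topology by blast

text \<open>Mutually inverse passages between topologies and quasi-orders on a finite set.\<close>

lemma le_top_final_segment_topology:
  assumes "\<And>x. x \<in> X \<Longrightarrow> Q x x" "\<And>x y z. Q x y \<Longrightarrow> Q y z \<Longrightarrow> Q x z"
  shows "le_top (final_segment_topology X Q) x y \<longleftrightarrow> x \<in> X \<and> y \<in> X \<and> Q x y"
proof
  assume a: "le_top (final_segment_topology X Q) x y"
  then have X: "x \<in> X" "y \<in> X" by (auto simp: le_top_def)
  have "openin (final_segment_topology X Q) {z\<in>X. Q x z}"
    unfolding openin_final_segment_topology using assms(2) by blast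
  with a X assms(1) show "x \<in> X \<and> y \<in> X \<and> Q x y"
    unfolding le_top_def by blast
qed (auto simp: le_top_def openin_final_segment_topology)

lemma final_segment_topology_le_top:
  assumes "finite (topspace T)"
  shows "final_segment_topology (topspace T) (le_top T) = T"
proof (rule topology_eq[THEN iffD2], intro allI iffI)
  fix U assume "openin T U"
  then show "openin (final_segment_topology (topspace T) (le_top T)) U"
    by (auto simp: openin_final_segment_topology le_top_def dest: openin_subset)
next
  fix U assume U: "openin (final_segment_topology (topspace T) (le_top T)) U"
  have "\<exists>V. openin T V \<and> x \<in> V \<and> V \<subseteq> U" if x: "x \<in> U" for x
  proof -
    let ?V = "\<Inter>{W. openin T W \<and> x \<in> W}"
    have xT: "x \<in> topspace T" using U x by (auto simp: openin_final_segment_topology)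
    have fin: "finite {W. openin T W \<and> x \<in> W}"
      by (rule finite_subset[of _ "Pow (topspace T)"]) (use assms in \<open>auto dest: openin_subset\<close>)
    have "openin T ?V"
      by (rule openin_Inter[OF fin]) (use xT in auto)
    moreover have "?V \<subseteq> U"
    proof
      fix y assume "y \<in> ?V"
      then have "le_top T x y" using xT by (auto simp: le_top_def)
      then show "y \<in> U" using U x by (auto simp: openin_final_segment_topology le_top_def)
    qed
    ultimately show ?thesis by blast
  qed
  then show "openin T U" by (subst openin_subopen) blast
qed

lemma topspace_quot_top [simp]: "topspace (T /\<^sub>t T') = topspace T"
  by (simp add: quot_top_def)

lemma le_top_quot_top:
  assumes "topspace T' = topspace T"
  shows "le_top (T /\<^sub>t T') = (quot_rel T T')\<^sup>+\<^sup>+"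
proof (intro ext)
  fix x y
  have "x \<in> topspace T \<and> y \<in> topspace T" if "(quot_rel T T')\<^sup>+\<^sup>+ x y"
    using that by induction (auto simp: quot_rel_def le_top_def assms)
  moreover have "(quot_rel T T')\<^sup>+\<^sup>+ x x" if "x \<in> topspace T" for x
    using that by (intro tranclp.r_into_trancl) (auto simp: quot_rel_def le_top_def)
  ultimately show "le_top (T /\<^sub>t T') x y = (quot_rel T T')\<^sup>+\<^sup>+ x y"
    unfolding quot_top_def by (subst le_top_final_segment_topology) (auto intro: tranclp_trans)
qed

lemma finite_topologies_on:
  assumes "finite X"
  shows "finite (topologies_on X)"
proof (rule finite_imageD)
  show "finite ((\<lambda>T. {U. openin T U}) ` topologies_on X)"
    by (rule finite_subset[of _ "Pow (Pow X)"])
       (use assms in \<open>auto simp: topologies_on_def dest: openin_subset\<close>)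
  show "inj_on (\<lambda>T. {U. openin T U}) (topologies_on X)"
    by (rule inj_onI) (metis mem_Collect_eq topology_eq)
qed


section \<open>The coproduct\<close>

abbreviation top_vs :: "'a set \<Rightarrow> ('a topology \<Rightarrow>\<^sub>0 'k::field) set" where
  "top_vs X \<equiv> free_vs (topologies_on X)"

definition coprod_Gamma ::
    "('a topology \<Rightarrow>\<^sub>0 'k::field) \<Rightarrow> ('a topology \<times> 'a topology \<Rightarrow>\<^sub>0 'k)" where
  "coprod_Gamma = lin_ext (\<lambda>T. \<Sum>T' | admissible T T'. basis_elt T' \<otimes>\<^sub>v basis_elt (T /\<^sub>t T'))"

lemma linear_coprod_Gamma: "Vector_Spaces.linear fscale fscale coprod_Gamma"
  unfolding coprod_Gamma_def by (rule linear_lin_ext)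

lemma coprod_Gamma_basis:
  "coprod_Gamma (basis_elt T) = (\<Sum>T' | admissible T T'. basis_elt T' \<otimes>\<^sub>v basis_elt (T /\<^sub>t T'))"
  unfolding coprod_Gamma_def by (rule lin_ext_basis)

lemma finite_admissible:
  assumes "finite (topspace T)"
  shows "finite {T'. admissible T T'}"
  by (rule finite_subset[OF _ finite_topologies_on[OF assms]])
     (auto simp: admissible_def finer_top_def topologies_on_def)

lemma free_vs_sum: "(\<And>i. i \<in> I \<Longrightarrow> f i \<in> free_vs S) \<Longrightarrow> sum f I \<in> free_vs S"
proof (induction I rule: infinite_finite_induct)
  case (insert i I)
  then show ?case
    using Poly_Mapping.keys_add[of "f i" "sum f I"] by (auto simp: free_vs_def)
qed (auto simp: free_vs_def)

lemma free_vs_scale: "z \<in> free_vs S \<Longrightarrow> fscale c z \<in> free_vs S"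
  by (auto simp: free_vs_def in_keys_iff subset_iff)

lemma coprod_Gamma_in_tensor:
  assumes "v \<in> top_vs X"
  shows "coprod_Gamma v \<in> free_vs (topologies_on X \<times> topologies_on X)"
proof -
  have "basis_elt T' \<otimes>\<^sub>v basis_elt (T /\<^sub>t T') \<in> free_vs (topologies_on X \<times> topologies_on X)"
    if "T \<in> Poly_Mapping.keys v" "admissible T T'" for T T'
    using that assms by (auto simp: free_vs_def admissible_def finer_top_def topologies_on_def)
  then show ?thesis
    unfolding coprod_Gamma_def lin_ext_def by (intro free_vs_sum free_vs_scale) blast
qed

end

theory Submission
  imports Defs
begin

text \<open>
  A \<open>T\<close>-admissible \<open>T'\<close> amounts to the partial equivalence relation \<open>E\<close> whose classes are the
  connected components of \<open>T'\<close>: the quasi-order of \<open>T'\<close> is \<open>\<le>\<^sub>T \<inter> E\<close>, and that of \<open>T / T'\<close> is the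
  transitive closure of \<open>\<le>\<^sub>T \<union> E\<close>. The relations \<open>E\<close> that occur are those with \<open>\<le>\<^sub>T\<close>-connected
  classes such that every cycle of \<open>\<le>\<^sub>T \<union> E\<close> stays in one class. If \<open>F\<close> is such a relation for \<open>T\<close>,
  then those of the restriction to \<open>F\<close> are the ones of \<open>T\<close> contained in \<open>F\<close>; if \<open>E\<close> is one, then
  those of the quotient by \<open>E\<close> are the ones of \<open>T\<close> containing \<open>E\<close>. So both iterated coproducts are
  sums over the pairs \<open>E \<subseteq> F\<close>, taken in opposite orders.
\<close>

section \<open>Contractions of a relation\<close>

lemmas transp_tranclp = trans_trancl[to_pred]
lemmas tranclp_mono = trancl_mono_subset[to_pred]

lemma tranclp_least:
  assumes "R \<le> S" "transp S"
  shows "R\<^sup>+\<^sup>+ \<le> S"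
proof (rule predicate2I)
  fix x y assume "R\<^sup>+\<^sup>+ x y"
  then show "S x y"
    by induction (use assms in \<open>auto dest: transpD\<close>)
qed

definition part_equivclp :: "('a \<Rightarrow> 'a \<Rightarrow> bool) \<Rightarrow> 'a \<Rightarrow> 'a \<Rightarrow> bool" where
  "part_equivclp R = (symclp R)\<^sup>+\<^sup>+"

lemma transp_part_equivclp: "transp (part_equivclp R)"
  unfolding part_equivclp_def by (rule transp_tranclp)

lemma symp_part_equivclp: "symp (part_equivclp R)"
  unfolding part_equivclp_def by (rule sym_trancl[to_pred]) simp

lemma part_equivclp_greater: "R \<le> part_equivclp R"
  unfolding part_equivclp_def by (auto simp: symclp_def)

lemma part_equivclp_least:
  assumes "R \<le> S" "symp S" "transp S"
  shows "part_equivclp R \<le> S"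
  unfolding part_equivclp_def
  by (rule tranclp_least) (use assms in \<open>auto simp: symclp_pointfree dest: sympD\<close>)

lemma part_equivclp_mono: "R \<le> S \<Longrightarrow> part_equivclp R \<le> part_equivclp S"
  by (meson order_trans part_equivclp_greater part_equivclp_least symp_part_equivclp
      transp_part_equivclp)

definition collapse :: "('a \<Rightarrow> 'a \<Rightarrow> bool) \<Rightarrow> ('a \<Rightarrow> 'a \<Rightarrow> bool) \<Rightarrow> 'a \<Rightarrow> 'a \<Rightarrow> bool" where
  "collapse L E = (sup L E)\<^sup>+\<^sup>+"

lemma transp_collapse: "transp (collapse L E)"
  unfolding collapse_def by (rule transp_tranclp)

lemma collapse_upper1: "L \<le> collapse L E"
  and collapse_upper2: "E \<le> collapse L E"
  by (auto simp: collapse_def)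

lemma collapse_least:
  assumes "L \<le> S" "E \<le> S" "transp S"
  shows "collapse L E \<le> S"
  unfolding collapse_def using assms by (intro tranclp_least sup_least)

lemma collapse_mono:
  assumes "L \<le> L'" "E \<le> E'"
  shows "collapse L E \<le> collapse L' E'"
  unfolding collapse_def using assms by (intro tranclp_mono sup_mono)

lemma collapse_collapse: "collapse (collapse L E) F = collapse L (sup E F)"
proof (rule antisym)
  show "collapse (collapse L E) F \<le> collapse L (sup E F)"
    by (intro collapse_least collapse_mono transp_collapse)
       (use collapse_upper2[of "sup E F" L] in auto)
  show "collapse L (sup E F) \<le> collapse (collapse L E) F"
    by (meson collapse_least collapse_upper1 collapse_upper2 order_trans sup_least transp_collapse)
qed

lemma collapse_conversep:
  assumes "R \<le> L"
  shows "collapse L R\<inverse>\<inverse> = collapse L (part_equivclp R)"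
proof (rule antisym)
  have "R\<inverse>\<inverse> \<le> part_equivclp R"
    using part_equivclp_greater[of R] symp_part_equivclp[of R] by (auto dest: sympD)
  then show "collapse L R\<inverse>\<inverse> \<le> collapse L (part_equivclp R)"
    by (intro collapse_mono order_refl)
  have "part_equivclp R \<le> collapse L R\<inverse>\<inverse>"
    unfolding part_equivclp_def collapse_def symclp_pointfree
    by (intro tranclp_mono sup_mono assms order_refl)
  then show "collapse L (part_equivclp R) \<le> collapse L R\<inverse>\<inverse>"
    by (intro collapse_least collapse_upper1 transp_collapse)
qed

definition acyclic_modulo :: "('a \<Rightarrow> 'a \<Rightarrow> bool) \<Rightarrow> ('a \<Rightarrow> 'a \<Rightarrow> bool) \<Rightarrow> bool" where
  "acyclic_modulo L E \<longleftrightarrow> (\<forall>x y. collapse L E x y \<longrightarrow> collapse L E y x \<longrightarrow> E x y)"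

lemma acyclic_moduloD:
  "acyclic_modulo L E \<Longrightarrow> collapse L E x y \<Longrightarrow> collapse L E y x \<Longrightarrow> E x y"
  by (auto simp: acyclic_modulo_def)

lemma acyclic_modulo_collapse_le:
  assumes "symp E" "acyclic_modulo (collapse L E) F"
  shows "E \<le> F"
proof (rule predicate2I)
  fix x y assume "E x y"
  moreover from this have "E y x" using assms(1) by (rule sympD[rotated])
  moreover have "E \<le> collapse (collapse L E) F"
    using collapse_upper2 collapse_upper1 by (rule order_trans)
  ultimately show "F x y" using acyclic_moduloD[OF assms(2)] by blast
qed

lemma inf_collapse_le:
  assumes F: "symp F" "acyclic_modulo L F" and EF: "E \<le> F"
  shows "inf (collapse L E) F \<le> collapse (inf L F) E"
proof -
  have "collapse (inf L F) E x y" if "collapse L E x y" "F x y" for x y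
    using that unfolding collapse_def
  proof (induction rule: converse_tranclp_induct)
    case (base x)
    then show ?case by auto
  next
    case (step x z)
    \<comment> \<open>Modulo \<open>F\<close>, the path closes up to a cycle, so it never leaves the class of \<open>y\<close>.\<close>
    have xz: "collapse L F x z"
      using step.hyps(1) EF unfolding collapse_def by auto
    have zy: "collapse L F z y"
      using step.hyps(2) collapse_mono[OF order_refl EF, of L] unfolding collapse_def by auto
    have yx: "collapse L F y x"
      using step.prems F(1) collapse_upper2[of F L] by (auto dest: sympD)
    have "F x z" "F z y"
      using xz zy yx by (meson acyclic_moduloD[OF F(2)] transpD[OF transp_collapse])+
    have "sup (inf L F) E x z"
      using step.hyps(1) \<open>F x z\<close> by auto
    with step.IH[OF \<open>F z y\<close>] show ?case by (rule tranclp_into_tranclp2[rotated])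
  qed
  then show ?thesis by auto
qed

definition contraction :: "('a \<Rightarrow> 'a \<Rightarrow> bool) \<Rightarrow> ('a \<Rightarrow> 'a \<Rightarrow> bool) \<Rightarrow> bool" where
  "contraction L E \<longleftrightarrow> part_equivclp (inf L E) = E \<and> acyclic_modulo L E"

lemma contractionD:
  assumes "contraction L E"
  shows "part_equivclp (inf L E) = E" "acyclic_modulo L E" "symp E" "transp E"
  using assms unfolding contraction_def by (metis symp_part_equivclp transp_part_equivclp)+

lemma contraction_le: "contraction L E \<Longrightarrow> E \<le> part_equivclp L"
  by (metis contractionD(1) inf_le1 part_equivclp_mono)

lemma inf_collapse:
  assumes F: "contraction L F" and EF: "E \<le> F"
  shows "inf (collapse L E) F = collapse (inf L F) E"
proof (rule antisym)
  show "inf (collapse L E) F \<le> collapse (inf L F) E"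
    using contractionD(3,2)[OF F] EF by (rule inf_collapse_le)
  show "collapse (inf L F) E \<le> inf (collapse L E) F"
    using EF contractionD(4)[OF F] by (intro le_infI collapse_mono collapse_least) auto
qed

lemma contraction_inf_iff:
  assumes F: "contraction L F"
  shows "contraction (inf L F) E \<longleftrightarrow> contraction L E \<and> E \<le> F"
proof -
  have "E \<le> F" if "contraction (inf L F) E"
  proof -
    have "part_equivclp (inf (inf L F) E) \<le> F"
      using contractionD(3,4)[OF F] by (intro part_equivclp_least) auto
    then show ?thesis by (simp add: contractionD(1)[OF that])
  qed
  moreover have "contraction (inf L F) E \<longleftrightarrow> contraction L E" if EF: "E \<le> F"
  proof -
    have "F x y" if "collapse L E x y" "collapse L E y x" for x y
      using that collapse_mono[OF order_refl EF, of L] acyclic_moduloD[OF contractionD(2)[OF F]]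
      by blast
    then have "acyclic_modulo (inf L F) E \<longleftrightarrow> acyclic_modulo L E"
      unfolding acyclic_modulo_def inf_collapse[OF F EF, symmetric] by auto
    moreover have "inf (inf L F) E = inf L E"
      using EF by (simp add: inf_assoc inf_absorb2)
    ultimately show ?thesis by (simp add: contraction_def)
  qed
  ultimately show ?thesis by blast
qed

lemma part_equivclp_inf_collapse:
  assumes F: "symp F" "acyclic_modulo L F" and EF: "E \<le> F" and E: "part_equivclp (inf L E) = E"
  shows "part_equivclp (inf (collapse L E) F) = part_equivclp (inf L F)"
proof (rule antisym)
  have "E \<le> part_equivclp (inf L F)"
    using part_equivclp_mono[of "inf L E" "inf L F"] EF E by (simp add: le_infI2)
  then have "collapse (inf L F) E \<le> part_equivclp (inf L F)"
    by (intro collapse_least part_equivclp_greater transp_part_equivclp)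
  then have "inf (collapse L E) F \<le> part_equivclp (inf L F)"
    using inf_collapse_le[OF F EF] by (rule order_trans[rotated])
  then show "part_equivclp (inf (collapse L E) F) \<le> part_equivclp (inf L F)"
    by (intro part_equivclp_least symp_part_equivclp transp_part_equivclp)
  show "part_equivclp (inf L F) \<le> part_equivclp (inf (collapse L E) F)"
    by (intro part_equivclp_mono inf_mono collapse_upper1 order_refl)
qed

lemma contraction_collapse_iff:
  assumes E: "contraction L E"
  shows "contraction (collapse L E) F \<longleftrightarrow> contraction L F \<and> E \<le> F"
proof -
  have "E \<le> F" if "contraction (collapse L E) F"
    using contractionD(3)[OF E] contractionD(2)[OF that] by (rule acyclic_modulo_collapse_le)
  moreover have "contraction (collapse L E) F \<longleftrightarrow> contraction L F" if EF: "E \<le> F"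
  proof -
    have acyclic: "acyclic_modulo (collapse L E) F \<longleftrightarrow> acyclic_modulo L F"
      unfolding acyclic_modulo_def collapse_collapse sup_absorb2[OF EF] ..
    show ?thesis
      using part_equivclp_inf_collapse[OF _ _ EF contractionD(1)[OF E]] acyclic
      by (metis contraction_def symp_part_equivclp)
  qed
  ultimately show ?thesis by blast
qed


section \<open>Connected components of a finite topology\<close>

lemma le_top_refl: "x \<in> topspace T \<Longrightarrow> le_top T x x"
  by (auto simp: le_top_def)

lemma transp_le_top: "transp (le_top T)"
  by (auto simp: le_top_def intro!: transpI)

lemma le_top_subtopology:
  "le_top (subtopology T Y) x y \<longleftrightarrow> x \<in> Y \<and> y \<in> Y \<and> le_top T x y"
  unfolding le_top_def openin_subtopology topspace_subtopology by blast

lemma le_top_inject: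
  assumes "finite (topspace T)" "topspace T' = topspace T" "le_top T' = le_top T"
  shows "T' = T"
  by (metis assms final_segment_topology_le_top)

lemma openin_iff_final_segment:
  assumes "finite (topspace T)"
  shows "openin T U \<longleftrightarrow> U \<subseteq> topspace T \<and> (\<forall>x\<in>U. \<forall>y. le_top T x y \<longrightarrow> y \<in> U)"
proof -
  have "openin T U \<longleftrightarrow> openin (final_segment_topology (topspace T) (le_top T)) U"
    by (simp add: final_segment_topology_le_top assms)
  also have "\<dots> \<longleftrightarrow> U \<subseteq> topspace T \<and> (\<forall>x\<in>U. \<forall>y. le_top T x y \<longrightarrow> y \<in> U)"
    unfolding openin_final_segment_topology by (auto simp: le_top_def)
  finally show ?thesis .
qed

lemma finer_top_iff_le_top:
  assumes "finite (topspace T)"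
  shows "T' \<prec>\<^sub>t T \<longleftrightarrow> topspace T' = topspace T \<and> le_top T' \<le> le_top T"
proof
  assume "T' \<prec>\<^sub>t T"
  then show "topspace T' = topspace T \<and> le_top T' \<le> le_top T"
    by (auto simp: finer_top_def le_top_def)
next
  assume le: "topspace T' = topspace T \<and> le_top T' \<le> le_top T"
  then have "finite (topspace T')" using assms by simp
  with le show "T' \<prec>\<^sub>t T"
    unfolding finer_top_def by (auto simp: openin_iff_final_segment assms)
qed

lemma symp_connected_component_of: "symp (connected_component_of T)"
  using connected_component_of_sym by (metis sympI)

lemma transp_connected_component_of: "transp (connected_component_of T)"
  using connected_component_of_trans by (rule transpI)

lemma le_top_le_component: "le_top T \<le> connected_component_of T"
proof (rule predicate2I)
  fix x y assume "le_top T x y"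
  then have "connectedin T {x, y}"
    unfolding connectedin le_top_def by blast
  then show "connected_component_of T x y"
    unfolding connected_component_of_def by (intro exI[of _ "{x, y}"]) simp
qed

lemma part_equivclp_le_top_le_component: "part_equivclp (le_top T) \<le> connected_component_of T"
  by (intro part_equivclp_least le_top_le_component symp_connected_component_of
      transp_connected_component_of)

lemma connected_component_of_eq_part_equivclp:
  assumes fin: "finite (topspace T)"
  shows "connected_component_of T = part_equivclp (le_top T)"
proof (rule antisym[OF predicate2I part_equivclp_le_top_le_component])
  fix x y assume xy: "connected_component_of T x y"
  let ?C = "{z. part_equivclp (le_top T) x z}"
  have C: "?C \<subseteq> topspace T"
    using part_equivclp_le_top_le_component[of T] connected_component_in_topspace by fast
  have iff: "part_equivclp (le_top T) x z \<longleftrightarrow> part_equivclp (le_top T) x w" if "le_top T z w" for z w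
    using that part_equivclp_greater[of "le_top T"]
    by (meson predicate2D symp_part_equivclp sympD transp_part_equivclp transpD)
  have "openin T ?C"
    unfolding openin_iff_final_segment[OF fin] using C iff by blast
  moreover have "openin T (topspace T - ?C)"
    unfolding openin_iff_final_segment[OF fin] using iff by (auto simp: le_top_def)
  then have "closedin T ?C"
    using C by (simp add: closedin_def)
  moreover have "x \<in> ?C"
    using xy part_equivclp_greater[of "le_top T"] connected_component_in_topspace le_top_refl
    by fast
  ultimately show "part_equivclp (le_top T) x y"
    using xy connectedin_clopen_cases unfolding connected_component_of_def disjnt_iff by blast
qed


section \<open>Admissible topologies as contractions\<close>

lemma subtopology_eq_on_connectedin_iff:
  assumes fin: "finite (topspace T)" and top: "topspace T' = topspace T"
  shows "(\<forall>Y. connectedin T' Y \<longrightarrow> subtopology T' Y = subtopology T Y) \<longleftrightarrow>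
    le_top T' = inf (le_top T) (connected_component_of T')"
proof
  assume sub: "\<forall>Y. connectedin T' Y \<longrightarrow> subtopology T' Y = subtopology T Y"
  have "le_top T' x y \<longleftrightarrow> le_top T x y" if xy: "connected_component_of T' x y" for x y
  proof -
    obtain Y where "connectedin T' Y" "x \<in> Y" "y \<in> Y"
      using xy unfolding connected_component_of_def by blast
    with sub show ?thesis using le_top_subtopology by metis
  qed
  then show "le_top T' = inf (le_top T) (connected_component_of T')"
    using predicate2D[OF le_top_le_component[of T']] by (intro ext) auto
next
  assume eq: "le_top T' = inf (le_top T) (connected_component_of T')"
  show "\<forall>Y. connectedin T' Y \<longrightarrow> subtopology T' Y = subtopology T Y"
  proof (intro allI impI)
    fix Y assume "connectedin T' Y"
    then have "connected_component_of T' x y" if "x \<in> Y" "y \<in> Y" for x y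
      using that unfolding connected_component_of_def by blast
    then have "le_top (subtopology T' Y) = le_top (subtopology T Y)"
      by (intro ext) (auto simp: le_top_subtopology eq)
    then show "subtopology T' Y = subtopology T Y"
      by (intro le_top_inject) (auto simp: fin top topspace_subtopology)
  qed
qed

lemma tranclp_quot_rel_eq_collapse:
  assumes "finite (topspace T')" "le_top T' \<le> le_top T"
  shows "(quot_rel T T')\<^sup>+\<^sup>+ = collapse (le_top T) (connected_component_of T')"
proof -
  have "quot_rel T T' = sup (le_top T) (le_top T')\<inverse>\<inverse>"
    by (intro ext) (auto simp: quot_rel_def)
  then have "(quot_rel T T')\<^sup>+\<^sup>+ = collapse (le_top T) (le_top T')\<inverse>\<inverse>"
    by (simp add: collapse_def)
  then show ?thesis
    by (simp add: collapse_conversep[OF assms(2)]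
        connected_component_of_eq_part_equivclp[OF assms(1)])
qed

lemma sim_top_quot_top_self:
  assumes "finite (topspace T)"
  shows "sim_top (T /\<^sub>t T) = connected_component_of T"
proof -
  have "quot_rel T T = symclp (le_top T)"
    by (intro ext) (auto simp: quot_rel_def symclp_def)
  then have "le_top (T /\<^sub>t T) = connected_component_of T"
    by (simp add: le_top_quot_top connected_component_of_eq_part_equivclp[OF assms]
        part_equivclp_def)
  then show ?thesis
    by (intro ext) (auto simp: sim_top_def connected_component_of_sym)
qed

lemma sim_top_quot_top_iff_acyclic_modulo:
  assumes fin: "finite (topspace T)" and top: "topspace T' = topspace T"
    and le: "le_top T' \<le> le_top T"
  shows "(\<forall>x\<in>topspace T. \<forall>y\<in>topspace T. sim_top (T /\<^sub>t T') x y \<longleftrightarrow> sim_top (T' /\<^sub>t T') x y) \<longleftrightarrow>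
    acyclic_modulo (le_top T) (connected_component_of T')"
proof -
  let ?C = "connected_component_of T'"
  have fin': "finite (topspace T')" using fin top by simp
  have sim: "sim_top (T /\<^sub>t T') x y \<longleftrightarrow> collapse (le_top T) ?C x y \<and> collapse (le_top T) ?C y x"
    for x y
    by (simp add: sim_top_def le_top_quot_top[OF top] tranclp_quot_rel_eq_collapse[OF fin' le])
  have "?C x y \<Longrightarrow> sim_top (T /\<^sub>t T') x y" for x y
    using collapse_upper2[of ?C "le_top T"] connected_component_of_sym[of T'] unfolding sim by blast
  moreover have "sim_top (T /\<^sub>t T') x y \<Longrightarrow> x \<in> topspace T \<and> y \<in> topspace T" for x y
    by (simp add: sim_top_def le_top_def)
  ultimately show ?thesis
    unfolding acyclic_modulo_def sim_top_quot_top_self[OF fin'] by (meson sim)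
qed

lemma admissible_iff_contraction:
  assumes fin: "finite (topspace T)"
  shows "admissible T T' \<longleftrightarrow> topspace T' = topspace T \<and>
    le_top T' = inf (le_top T) (connected_component_of T') \<and>
    contraction (le_top T) (connected_component_of T')"
    (is "_ \<longleftrightarrow> ?top \<and> ?inf \<and> _")
proof (cases "?top \<and> ?inf")
  case True
  then have le: "le_top T' \<le> le_top T" by (metis inf_le1)
  have fin': "finite (topspace T')" using True fin by simp
  have "part_equivclp (inf (le_top T) (connected_component_of T')) = connected_component_of T'"
    using True connected_component_of_eq_part_equivclp[OF fin'] by simp
  then show ?thesis
    unfolding admissible_def contraction_def finer_top_iff_le_top[OF fin]
    using True le
    by (auto simp: subtopology_eq_on_connectedin_iff[OF fin]
        sim_top_quot_top_iff_acyclic_modulo[OF fin])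
next
  case False
  then show ?thesis
    unfolding admissible_def finer_top_iff_le_top[OF fin]
    using subtopology_eq_on_connectedin_iff[OF fin] by blast
qed

definition restrict_top :: "'a topology \<Rightarrow> ('a \<Rightarrow> 'a \<Rightarrow> bool) \<Rightarrow> 'a topology" where
  "restrict_top T E = final_segment_topology (topspace T) (inf (le_top T) E)"

definition collapse_top :: "'a topology \<Rightarrow> ('a \<Rightarrow> 'a \<Rightarrow> bool) \<Rightarrow> 'a topology" where
  "collapse_top T E = final_segment_topology (topspace T) (collapse (le_top T) E)"

lemma topspace_restrict_top [simp]: "topspace (restrict_top T E) = topspace T"
  by (simp add: restrict_top_def)

lemma topspace_collapse_top [simp]: "topspace (collapse_top T E) = topspace T"
  by (simp add: collapse_top_def)

lemma le_top_final_segment_topology_eq: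
  assumes "\<And>x. x \<in> X \<Longrightarrow> Q x x" "transp Q" "\<And>x y. Q x y \<Longrightarrow> x \<in> X \<and> y \<in> X"
  shows "le_top (final_segment_topology X Q) = Q"
  using assms(3)
  by (intro ext, subst le_top_final_segment_topology) (auto intro: assms(1) transpD[OF assms(2)])

lemma le_top_restrict_top:
  assumes "contraction (le_top T) E"
  shows "le_top (restrict_top T E) = inf (le_top T) E"
  unfolding restrict_top_def
proof (rule le_top_final_segment_topology_eq)
  show "inf (le_top T) E x x" if "x \<in> topspace T" for x
  proof -
    have "collapse (le_top T) E x x"
      using collapse_upper1 le_top_refl[OF that] by (rule predicate2D)
    then have "E x x" by (intro acyclic_moduloD[OF contractionD(2)[OF assms]])
    with le_top_refl[OF that] show ?thesis by simp
  qed
  show "transp (inf (le_top T) E)"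
    using transpD[OF transp_le_top] transpD[OF contractionD(4)[OF assms]] by (auto intro!: transpI)
qed (auto simp: le_top_def)

lemma le_top_collapse_top:
  assumes "contraction (le_top T) E"
  shows "le_top (collapse_top T E) = collapse (le_top T) E"
  unfolding collapse_top_def
proof (rule le_top_final_segment_topology_eq)
  show "collapse (le_top T) E x x" if "x \<in> topspace T" for x
    using collapse_upper1 le_top_refl[OF that] by (rule predicate2D)
  have "E \<le> connected_component_of T"
    using contraction_le[OF assms] part_equivclp_le_top_le_component by (rule order_trans)
  then have "collapse (le_top T) E \<le> (\<lambda>x y. x \<in> topspace T \<and> y \<in> topspace T)"
    using connected_component_in_topspace
    by (intro collapse_least) (fastforce simp: le_top_def intro: transpI)+
  then show "x \<in> topspace T \<and> y \<in> topspace T" if "collapse (le_top T) E x y" for x y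
    using that by blast
qed (rule transp_collapse)

lemma restrict_restrict_top:
  assumes "contraction (le_top T) F" "E \<le> F"
  shows "restrict_top (restrict_top T F) E = restrict_top T E"
  using assms(2)
  by (simp add: restrict_top_def[of _ E] le_top_restrict_top[OF assms(1)] inf_assoc inf_absorb2)

lemma restrict_collapse_top:
  assumes E: "contraction (le_top T) E" and F: "contraction (le_top T) F" and "E \<le> F"
  shows "restrict_top (collapse_top T E) F = collapse_top (restrict_top T F) E"
proof -
  have "restrict_top (collapse_top T E) F =
      final_segment_topology (topspace T) (inf (collapse (le_top T) E) F)"
    by (simp add: restrict_top_def le_top_collapse_top[OF E])
  also have "\<dots> = collapse_top (restrict_top T F) E"
    by (simp add: collapse_top_def le_top_restrict_top[OF F] inf_collapse[OF F \<open>E \<le> F\<close>])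
  finally show ?thesis .
qed

lemma collapse_collapse_top:
  assumes "contraction (le_top T) E" "E \<le> F"
  shows "collapse_top (collapse_top T E) F = collapse_top T F"
  using assms(2)
  by (simp add: collapse_top_def[of _ F] le_top_collapse_top[OF assms(1)] collapse_collapse
      sup_absorb2)

lemma connected_component_of_restrict_top:
  assumes "finite (topspace T)" "contraction (le_top T) E"
  shows "connected_component_of (restrict_top T E) = E"
  using assms
  by (simp add: connected_component_of_eq_part_equivclp le_top_restrict_top contractionD(1))

lemma admissible_restrict_top:
  assumes "finite (topspace T)" "contraction (le_top T) E"
  shows "admissible T (restrict_top T E)"
  using assms
  by (simp add: admissible_iff_contraction connected_component_of_restrict_top le_top_restrict_top)

lemma restrict_top_connected_component_of:
  assumes "finite (topspace T)" "admissible T T'"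
  shows "restrict_top T (connected_component_of T') = T'"
  using assms
  by (metis admissible_iff_contraction final_segment_topology_le_top restrict_top_def)

lemma bij_betw_restrict_top:
  assumes "finite (topspace T)"
  shows "bij_betw (restrict_top T) {E. contraction (le_top T) E} {T'. admissible T T'}"
  by (rule bij_betw_byWitness[where f' = connected_component_of])
     (use assms in \<open>auto simp: connected_component_of_restrict_top admissible_restrict_top
        restrict_top_connected_component_of dest: admissible_iff_contraction[THEN iffD1]\<close>)

lemma quot_top_restrict_top:
  assumes fin: "finite (topspace T)" and E: "contraction (le_top T) E"
  shows "T /\<^sub>t restrict_top T E = collapse_top T E"
  using tranclp_quot_rel_eq_collapse[of "restrict_top T E" T]
  by (simp add: quot_top_def collapse_top_def fin le_top_restrict_top[OF E]
      connected_component_of_restrict_top[OF fin E])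

lemma finite_contractions:
  assumes "finite (topspace T)"
  shows "finite {E. contraction (le_top T) E}"
  using bij_betw_finite[OF bij_betw_restrict_top] finite_admissible assms by blast


section \<open>Coassociativity\<close>

lemma free_vs_subset_span:
  "free_vs S \<subseteq> module.span fscale (basis_elt ` S :: ('b \<Rightarrow>\<^sub>0 'k::field) set)"
proof
  interpret vector_space "fscale :: 'k \<Rightarrow> ('b \<Rightarrow>\<^sub>0 'k) \<Rightarrow> _" by (rule vector_space_fscale)
  fix v :: "'b \<Rightarrow>\<^sub>0 'k" assume v: "v \<in> free_vs S"
  have "v = (\<Sum>b\<in>Poly_Mapping.keys v. fscale (Poly_Mapping.lookup v b) (basis_elt b))"
    by (rule poly_mapping_eqI)
       (simp add: lookup_sum lookup_single when_def in_keys_iff if_distrib cong: if_cong)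
  also have "\<dots> \<in> span (basis_elt ` S)"
    using v by (intro span_sum span_scale span_base) (auto simp: free_vs_def)
  finally show "v \<in> span (basis_elt ` S)" .
qed

lemma linear_eq_on_free_vs:
  fixes f :: "('b \<Rightarrow>\<^sub>0 'k::field) \<Rightarrow> 'w::ab_group_add"
  assumes f: "Vector_Spaces.linear fscale s f" and g: "Vector_Spaces.linear fscale s g"
    and v: "v \<in> free_vs S"
    and eq: "\<And>b. b \<in> S \<Longrightarrow> f (basis_elt b) = g (basis_elt b)"
  shows "f v = g v"
proof -
  interpret vector_space_pair "fscale :: 'k \<Rightarrow> ('b \<Rightarrow>\<^sub>0 'k) \<Rightarrow> _" s
    using f unfolding Vector_Spaces.linear_iff vector_space_pair_def by blast
  show ?thesis
    using linear_eq_on[OF f g] v free_vs_subset_span eq by blast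
qed

lemmas linear_sum = module_hom.sum[OF module_hom_linearI]

lemma linear_tensor_map: "Vector_Spaces.linear fscale fscale (tensor_map f g)"
  unfolding tensor_map_def by (rule linear_lin_ext)

lemma tensor_map_basis:
  "tensor_map f g (basis_elt (b, c)) = f (basis_elt b) \<otimes>\<^sub>v g (basis_elt c)"
  by (simp add: tensor_map_def)

lemma tensor_assoc_basis: "tensor_assoc (basis_elt ((b, c), d)) = basis_elt (b, c, d)"
  by (simp add: tensor_assoc_def)

lemma coprod_Gamma_eq_sum_contractions:
  assumes fin: "finite (topspace T)"
  shows "coprod_Gamma (basis_elt T) =
    (\<Sum>E | contraction (le_top T) E. basis_elt (restrict_top T E, collapse_top T E))"
proof -
  have "coprod_Gamma (basis_elt T) = (\<Sum>T' | admissible T T'. basis_elt (T', T /\<^sub>t T'))"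
    by (simp add: coprod_Gamma_basis)
  also have "\<dots> = (\<Sum>E | contraction (le_top T) E.
      basis_elt (restrict_top T E, T /\<^sub>t restrict_top T E))"
    by (rule sum.reindex_bij_betw[OF bij_betw_restrict_top[OF fin], symmetric])
  also have "\<dots> = (\<Sum>E | contraction (le_top T) E. basis_elt (restrict_top T E, collapse_top T E))"
    by (rule sum.cong) (simp_all add: quot_top_restrict_top fin)
  finally show ?thesis .
qed

lemma coprod_Gamma_tensor_id_basis:
  assumes fin: "finite (topspace T)"
  shows "tensor_assoc (tensor_map coprod_Gamma id (coprod_Gamma (basis_elt T))) =
    (\<Sum>F | contraction (le_top T) F. \<Sum>E | contraction (le_top T) E \<and> E \<le> F.
      basis_elt (restrict_top T E, collapse_top (restrict_top T F) E, collapse_top T F))"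
proof -
  have "tensor_assoc (tensor_map coprod_Gamma id (coprod_Gamma (basis_elt T))) =
    (\<Sum>F | contraction (le_top T) F. \<Sum>E | contraction (le_top (restrict_top T F)) E.
      basis_elt (restrict_top (restrict_top T F) E, collapse_top (restrict_top T F) E,
        collapse_top T F))"
    by (simp add: coprod_Gamma_eq_sum_contractions fin tensor_map_basis tensor_assoc_basis
        linear_sum[OF linear_tensor_map] linear_sum[OF tensor_linear_left]
        linear_sum[OF linear_tensor_assoc])
  also have "\<dots> = (\<Sum>F | contraction (le_top T) F. \<Sum>E | contraction (le_top T) E \<and> E \<le> F.
      basis_elt (restrict_top T E, collapse_top (restrict_top T F) E, collapse_top T F))"
    by (intro sum.cong refl)
       (simp_all add: le_top_restrict_top contraction_inf_iff restrict_restrict_top)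
  finally show ?thesis .
qed

lemma id_tensor_coprod_Gamma_basis:
  assumes fin: "finite (topspace T)"
  shows "tensor_map id coprod_Gamma (coprod_Gamma (basis_elt T)) =
    (\<Sum>E | contraction (le_top T) E. \<Sum>F | contraction (le_top T) F \<and> E \<le> F.
      basis_elt (restrict_top T E, collapse_top (restrict_top T F) E, collapse_top T F))"
proof -
  have "tensor_map id coprod_Gamma (coprod_Gamma (basis_elt T)) =
    (\<Sum>E | contraction (le_top T) E. \<Sum>F | contraction (le_top (collapse_top T E)) F.
      basis_elt (restrict_top T E, restrict_top (collapse_top T E) F,
        collapse_top (collapse_top T E) F))"
    by (simp add: coprod_Gamma_eq_sum_contractions fin tensor_map_basis
        linear_sum[OF linear_tensor_map] linear_sum[OF tensor_linear_right])
  also have "\<dots> = (\<Sum>E | contraction (le_top T) E. \<Sum>F | contraction (le_top T) F \<and> E \<le> F.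
      basis_elt (restrict_top T E, collapse_top (restrict_top T F) E, collapse_top T F))"
    by (intro sum.cong refl)
       (simp_all add: le_top_collapse_top contraction_collapse_iff restrict_collapse_top
          collapse_collapse_top)
  finally show ?thesis .
qed

lemma coprod_Gamma_coassoc_basis:
  assumes fin: "finite (topspace T)"
  shows "tensor_assoc (tensor_map coprod_Gamma id (coprod_Gamma (basis_elt T))) =
    tensor_map id coprod_Gamma (coprod_Gamma (basis_elt T))"
  unfolding coprod_Gamma_tensor_id_basis[OF fin] id_tensor_coprod_Gamma_basis[OF fin]
  using sum.swap_restrict[OF finite_contractions finite_contractions, OF fin fin,
      where R = "\<lambda>F E. E \<le> F"]
  by simp

theorem theorem3p1:
  fixes X :: "'a set"
  assumes "finite X"
  shows "\<forall>v \<in> (top_vs X :: ('a topology \<Rightarrow>\<^sub>0 'k::field) set).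
           tensor_assoc (tensor_map coprod_Gamma id (coprod_Gamma v)) = tensor_map id coprod_Gamma (coprod_Gamma v)"
proof
  fix v :: "'a topology \<Rightarrow>\<^sub>0 'k"
  assume "v \<in> top_vs X"
  then show "tensor_assoc (tensor_map coprod_Gamma id (coprod_Gamma v)) =
      tensor_map id coprod_Gamma (coprod_Gamma v)"
  proof (rule linear_eq_on_free_vs[where s = fscale, rotated 2])
    fix T :: "'a topology"
    assume "T \<in> topologies_on X"
    then have "finite (topspace T)" using assms by (simp add: topologies_on_def)
    then show "tensor_assoc (tensor_map coprod_Gamma id (coprod_Gamma (basis_elt T :: _ \<Rightarrow>\<^sub>0 'k))) =
        tensor_map id coprod_Gamma (coprod_Gamma (basis_elt T))"
      by (rule coprod_Gamma_coassoc_basis)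
  qed (intro linear_compose'[OF linear_coprod_Gamma] linear_tensor_map
      linear_compose'[OF linear_tensor_map linear_tensor_assoc])+
qed

end
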